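(* Every sequent derivable in $\mathrm{NMVL}_R$ (from no additional sequents) has a derivation in $\mathrm{NMVL}_R$ that uses no application of the cut rule and no application of the resolution rule.
   Context: Fix a propositional language with a set of connectives, each connective $\ast$ having an arity $\ell$, and let $\mathcal{F}$ be its set of formulas. Fix truth values $V=\{v_1,\ldots,v_n\}$, $n\ge 2$. Each $\ell$-ary connective $\ast$ is given a non-deterministic truth table $\ast: V^\ell \to P(V)\setminus\{\emptyset\}$. A labelled formula is a pair $(\varphi,k)$ with $\varphi\in\mathcal{F}$, $k\in\{1,\ldots,n\}$. A sequent is $\Gamma\rightarrow\Delta$ with $\Gamma,\Delta$ finite (possibly empty) sets of labelled formulas; commas denote union. For $K\subseteq\{1,\dots,n\}$, $\overline{K}=\{1,\ldots,n\}\setminus K$ and $\{\varphi\}\times K=\{(\varphi,k):k\in K\}$. The calculus $\mathrm{NMVL}_R$ has axioms $(\psi,k)\rightarrow(\psi,k)$ for every formula $\psi$ and $k=1,\ldots,n$, and the following rules (for all finite sets $\Gamma,\Delta,\Delta',\Delta''$ of labelled formulas and formulas $\varphi$): - $k$-L-shift: from $\Gamma,(\varphi,k)\rightarrow\Delta$ infer $\Gamma\rightarrow\Delta,\{\varphi\}\times\overline{\{k\}}$; - $k',k''$-R-shift ($k'\ne k''$): from $\Gamma\rightarrow\Delta,(\varphi,k')$ infer $\Gamma,(\varphi,k'')\rightarrow\Delta$; - $k$-L-weakening: from $\Gamma\rightarrow\Delta$ infer $\Gamma,(\varphi,k)\rightarrow\Delta$; - $k$-R-weakening: from $\Gamma\rightarrow\Delta$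 infer $\Gamma\rightarrow\Delta,(\varphi,k)$; - $k$-cut: from $\Gamma\rightarrow\Delta,(\varphi,k)$ and $\Gamma,(\varphi,k)\rightarrow\Delta$ infer $\Gamma\rightarrow\Delta$; - $k',k''$-resolution ($k'\neq k''$): from $\Gamma\rightarrow\Delta',(\varphi,k')$ and $\Gamma\rightarrow\Delta'',(\varphi,k'')$ infer $\Gamma\rightarrow\Delta',\Delta''$; - table rules: for every connective $\ast$ of arity $\ell$, formulas $\varphi_1,\ldots,\varphi_\ell$ and $k_1,\ldots,k_\ell\in\{1,\dots,n\}$: from the premises $\Gamma\rightarrow\Delta,(\varphi_j,k_j)$, $j=1,\ldots,\ell$, infer $\Gamma\rightarrow\Delta,\{(\ast(\varphi_1,\ldots,\varphi_\ell),k): v_k\in\ast(v_{k_1},\ldots,v_{k_\ell})\}$. A sequent is derivable in $\mathrm{NMVL}_R$ if it has a derivation from the axioms using the rules. *)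

theory Defs
  imports Main
begin

datatype ('p, 'c) fm = Var 'p | Con 'c "('p, 'c) fm list"

text \<open>The formulas of the language in which the connective \<open>c\<close> has arity \<open>ar c\<close>;
  the datatype itself imposes no arities.\<close>

inductive_set formulas :: "('c \<Rightarrow> nat) \<Rightarrow> ('p, 'c) fm set" for ar :: "'c \<Rightarrow> nat" where
  Var: "Var p \<in> formulas ar"
| Con: "length \<phi>s = ar c \<Longrightarrow> (\<And>\<phi>. \<phi> \<in> set \<phi>s \<Longrightarrow> \<phi> \<in> formulas ar) \<Longrightarrow> Con c \<phi>s \<in> formulas ar"

text \<open>The truth values are the distinct elements \<open>v 1, \<dots>, v n\<close>. A truth table takes the list of
  its arguments; it is constrained only on lists of truth values of the correct length.\<close>

definition nmatrix :: "nat \<Rightarrow> (nat \<Rightarrow> 'v) \<Rightarrow> ('c \<Rightarrow> nat) \<Rightarrow> ('c \<Rightarrow> 'v list \<Rightarrow> 'v set) \<Rightarrow> bool" where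
  "nmatrix n v ar tab \<longleftrightarrow>
     2 \<le> n \<and> inj_on v {1..n} \<and>
     (\<forall>c xs. length xs = ar c \<longrightarrow> set xs \<subseteq> v ` {1..n} \<longrightarrow>
        tab c xs \<in> Pow (v ` {1..n}) - {{}})"

type_synonym ('p, 'c) lfm = "('p, 'c) fm \<times> nat"

definition lfms :: "nat \<Rightarrow> ('c \<Rightarrow> nat) \<Rightarrow> ('p, 'c) lfm set" where
  "lfms n ar = formulas ar \<times> {1..n}"

datatype ('p, 'c) sequent =
  Sequent "('p, 'c) lfm set" "('p, 'c) lfm set"  (infix \<open>\<turnstile>\<close> 50)

text \<open>Membership in \<open>fin_lfms\<close> restricts both sides of a sequent to finite sets of labelled formulas.\<close>

definition fin_lfms :: "nat \<Rightarrow> ('c \<Rightarrow> nat) \<Rightarrow> ('p, 'c) lfm set set" where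
  "fin_lfms n ar = {\<Gamma>. finite \<Gamma> \<and> \<Gamma> \<subseteq> lfms n ar}"

datatype rule_name =
  Axiom | LShift | RShift | LWeakening | RWeakening | Cut | Resolution | Table

text \<open>\<open>nmvl_rule n v ar tab r ss s\<close>: \<open>s\<close> is inferred from the list of premises \<open>ss\<close> by an
  instance of the rule \<open>r\<close>; axioms have no premises. A formula displayed next to a set may
  already belong to that set.\<close>

inductive nmvl_rule ::
    "nat \<Rightarrow> (nat \<Rightarrow> 'v) \<Rightarrow> ('c \<Rightarrow> nat) \<Rightarrow> ('c \<Rightarrow> 'v list \<Rightarrow> 'v set) \<Rightarrow>
     rule_name \<Rightarrow> ('p, 'c) sequent list \<Rightarrow> ('p, 'c) sequent \<Rightarrow> bool"
  for n :: nat and v :: "nat \<Rightarrow> 'v" and ar :: "'c \<Rightarrow> nat" and tab :: "'c \<Rightarrow> 'v list \<Rightarrow> 'v set"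
where
  Axiom:
    "(\<psi>, k) \<in> lfms n ar \<Longrightarrow>
     nmvl_rule n v ar tab Axiom [] ({(\<psi>, k)} \<turnstile> {(\<psi>, k)})"
| LShift:
    "\<Gamma> \<in> fin_lfms n ar \<Longrightarrow> \<Delta> \<in> fin_lfms n ar \<Longrightarrow> (\<phi>, k) \<in> lfms n ar \<Longrightarrow>
     nmvl_rule n v ar tab LShift
       [\<Gamma> \<union> {(\<phi>, k)} \<turnstile> \<Delta>]
       (\<Gamma> \<turnstile> \<Delta> \<union> {\<phi>} \<times> ({1..n} - {k}))"
| RShift:
    "\<Gamma> \<in> fin_lfms n ar \<Longrightarrow> \<Delta> \<in> fin_lfms n ar \<Longrightarrow>
     (\<phi>, k') \<in> lfms n ar \<Longrightarrow> (\<phi>, k'') \<in> lfms n ar \<Longrightarrow> k' \<noteq> k'' \<Longrightarrow>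
     nmvl_rule n v ar tab RShift
       [\<Gamma> \<turnstile> \<Delta> \<union> {(\<phi>, k')}]
       (\<Gamma> \<union> {(\<phi>, k'')} \<turnstile> \<Delta>)"
| LWeakening:
    "\<Gamma> \<in> fin_lfms n ar \<Longrightarrow> \<Delta> \<in> fin_lfms n ar \<Longrightarrow> (\<phi>, k) \<in> lfms n ar \<Longrightarrow>
     nmvl_rule n v ar tab LWeakening [\<Gamma> \<turnstile> \<Delta>] (\<Gamma> \<union> {(\<phi>, k)} \<turnstile> \<Delta>)"
| RWeakening:
    "\<Gamma> \<in> fin_lfms n ar \<Longrightarrow> \<Delta> \<in> fin_lfms n ar \<Longrightarrow> (\<phi>, k) \<in> lfms n ar \<Longrightarrow>
     nmvl_rule n v ar tab RWeakening [\<Gamma> \<turnstile> \<Delta>] (\<Gamma> \<turnstile> \<Delta> \<union> {(\<phi>, k)})"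
| Cut:
    "\<Gamma> \<in> fin_lfms n ar \<Longrightarrow> \<Delta> \<in> fin_lfms n ar \<Longrightarrow> (\<phi>, k) \<in> lfms n ar \<Longrightarrow>
     nmvl_rule n v ar tab Cut
       [\<Gamma> \<turnstile> \<Delta> \<union> {(\<phi>, k)}, \<Gamma> \<union> {(\<phi>, k)} \<turnstile> \<Delta>]
       (\<Gamma> \<turnstile> \<Delta>)"
| Resolution:
    "\<Gamma> \<in> fin_lfms n ar \<Longrightarrow> \<Delta>' \<in> fin_lfms n ar \<Longrightarrow> \<Delta>'' \<in> fin_lfms n ar \<Longrightarrow>
     (\<phi>, k') \<in> lfms n ar \<Longrightarrow> (\<phi>, k'') \<in> lfms n ar \<Longrightarrow> k' \<noteq> k'' \<Longrightarrow>
     nmvl_rule n v ar tab Resolution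
       [\<Gamma> \<turnstile> \<Delta>' \<union> {(\<phi>, k')}, \<Gamma> \<turnstile> \<Delta>'' \<union> {(\<phi>, k'')}]
       (\<Gamma> \<turnstile> \<Delta>' \<union> \<Delta>'')"
| Table:
    "\<Gamma> \<in> fin_lfms n ar \<Longrightarrow> \<Delta> \<in> fin_lfms n ar \<Longrightarrow>
     length \<phi>s = ar c \<Longrightarrow> set \<phi>s \<subseteq> formulas ar \<Longrightarrow>
     length ks = ar c \<Longrightarrow> set ks \<subseteq> {1..n} \<Longrightarrow>
     nmvl_rule n v ar tab Table
       (map (\<lambda>j. \<Gamma> \<turnstile> \<Delta> \<union> {(\<phi>s ! j, ks ! j)}) [0..<ar c])
       (\<Gamma> \<turnstile> \<Delta> \<union> {(Con c \<phi>s, k) |k. k \<in> {1..n} \<and> v k \<in> tab c (map v ks)})"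

datatype ('p, 'c) deriv =
  Infer (last_rule: rule_name) (subderivs: "('p, 'c) deriv list") (end_sequent: "('p, 'c) sequent")

primrec nmvl_derivation ::
    "nat \<Rightarrow> (nat \<Rightarrow> 'v) \<Rightarrow> ('c \<Rightarrow> nat) \<Rightarrow> ('c \<Rightarrow> 'v list \<Rightarrow> 'v set) \<Rightarrow> ('p, 'c) deriv \<Rightarrow> bool" where
  "nmvl_derivation n v ar tab (Infer r ds s) \<longleftrightarrow>
     nmvl_rule n v ar tab r (map end_sequent ds) s \<and> list_all (nmvl_derivation n v ar tab) ds"

primrec rules_used :: "('p, 'c) deriv \<Rightarrow> rule_name set" where
  "rules_used (Infer r ds s) = insert r (\<Union> (set (map rules_used ds)))"

definition nmvl_derivable ::
    "nat \<Rightarrow> (nat \<Rightarrow> 'v) \<Rightarrow> ('c \<Rightarrow> nat) \<Rightarrow> ('c \<Rightarrow> 'v list \<Rightarrow> 'v set) \<Rightarrow> ('p, 'c) sequent \<Rightarrow> bool" where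
  "nmvl_derivable n v ar tab s \<longleftrightarrow> (\<exists>d. nmvl_derivation n v ar tab d \<and> end_sequent d = s)"

end

theory Submission
  imports Defs
begin

text \<open>Cut elimination is proved semantically. The full calculus is sound for legal valuations. If
  \<open>\<Gamma> \<turnstile> \<Delta>\<close> is not cut-free derivable, extend \<open>\<Delta>\<close> to a maximal set \<open>M\<close> that contains no finite \<open>D\<close>
  with \<open>\<Gamma> \<turnstile> D\<close> cut-free derivable. A formula \<open>\<phi>\<close> may have several labels \<open>k\<close> with \<open>(\<phi>, k) \<notin> M\<close>;
  excluding this would need resolution. But the table rule shows that for \<^emph>\<open>every\<close> choice of such
  labels for the immediate subformulas, the table entry contains such a label for the compound
  formula, so a legal valuation avoiding \<open>M\<close> can be chosen by recursion. The right shift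
  leaves only the label \<open>k\<close> for \<open>\<phi>\<close> if \<open>(\<phi>, k) \<in> \<Gamma>\<close>, hence this valuation refutes \<open>\<Gamma> \<turnstile> \<Delta>\<close>.\<close>

section \<open>Legal valuations and soundness of the full calculus\<close>

text \<open>A valuation returns the index \<open>k\<close> of the truth value \<open>v k\<close>, so
  that it can be compared with labels directly.\<close>

definition legal ::
    "nat \<Rightarrow> (nat \<Rightarrow> 'v) \<Rightarrow> ('c \<Rightarrow> nat) \<Rightarrow> ('c \<Rightarrow> 'v list \<Rightarrow> 'v set) \<Rightarrow> (('p, 'c) fm \<Rightarrow> nat) \<Rightarrow> bool" where
  "legal n v ar tab w \<longleftrightarrow>
     (\<forall>\<phi> \<in> formulas ar. w \<phi> \<in> {1..n}) \<and>
     (\<forall>c \<phi>s. Con c \<phi>s \<in> formulas ar \<longrightarrow> v (w (Con c \<phi>s)) \<in> tab c (map v (map w \<phi>s)))"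

primrec satisfies :: "(('p, 'c) fm \<Rightarrow> nat) \<Rightarrow> ('p, 'c) sequent \<Rightarrow> bool" where
  "satisfies w (\<Gamma> \<turnstile> \<Delta>) \<longleftrightarrow> (\<forall>(\<phi>, k) \<in> \<Gamma>. w \<phi> = k) \<longrightarrow> (\<exists>(\<phi>, k) \<in> \<Delta>. w \<phi> = k)"

primrec wf_sequent :: "nat \<Rightarrow> ('c \<Rightarrow> nat) \<Rightarrow> ('p, 'c) sequent \<Rightarrow> bool" where
  "wf_sequent n ar (\<Gamma> \<turnstile> \<Delta>) \<longleftrightarrow> \<Gamma> \<in> fin_lfms n ar \<and> \<Delta> \<in> fin_lfms n ar"

lemma Con_in_formulas:
  "length \<phi>s = ar c \<Longrightarrow> set \<phi>s \<subseteq> formulas ar \<Longrightarrow> Con c \<phi>s \<in> formulas ar"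
  by (auto intro: formulas.Con)

text \<open>The side conditions of each rule already put both sides of its conclusion in
  \<open>fin_lfms\<close>; the last inference of a derivation therefore settles its end
  sequent.\<close>

lemma nmvl_rule_wf_sequent:
  assumes "nmvl_rule n v ar tab r ss s"
  shows "wf_sequent n ar s"
  using assms
proof cases
  case (Table \<Gamma> \<Delta> \<phi>s c ks)
  then show ?thesis
    using Con_in_formulas[of \<phi>s ar c] by (auto simp: fin_lfms_def lfms_def)
qed (auto simp: fin_lfms_def lfms_def)

lemma nmvl_rule_sound:
  assumes "nmvl_rule n v ar tab r ss s" and "legal n v ar tab w" and "\<forall>t \<in> set ss. satisfies w t"
  shows "satisfies w s"
  using assms(1)
proof cases
  case (LShift \<Gamma> \<Delta> \<phi> k)
  \<comment> \<open>If \<open>w \<phi>\<close> differs from \<open>k\<close>, this makes it one of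
    the labels that the shift adds on the right.\<close>
  then have "w \<phi> \<in> {1..n}"
    using assms(2) by (auto simp: legal_def lfms_def)
  with LShift assms(3) show ?thesis by (auto 0 3)
next
  case (Table \<Gamma> \<Delta> \<phi>s c ks)
  have legal_Con: "w (Con c \<phi>s) \<in> {1..n}" "v (w (Con c \<phi>s)) \<in> tab c (map v (map w \<phi>s))"
    using assms(2) Con_in_formulas[of \<phi>s ar c] Table by (auto simp: legal_def)
  show ?thesis
  proof (cases "satisfies w (\<Gamma> \<turnstile> \<Delta>)")
    case True
    then show ?thesis using Table by auto
  next
    case False
    \<comment> \<open>As the context fails, each premise can hold only through its displayed
      labelled formula.\<close>
    have "w (\<phi>s ! j) = ks ! j" if "j < ar c" for j
      using assms(3) Table that False by auto
    then have "map w \<phi>s = ks"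
      using Table by (auto intro: nth_equalityI)
    then show ?thesis using legal_Con Table by auto
  qed
qed (use assms(3) in \<open>auto 0 3\<close>)

lemma nmvl_derivation_sound:
  assumes "legal n v ar tab w" and "nmvl_derivation n v ar tab d"
  shows "satisfies w (end_sequent d)"
  using assms(2)
proof (induction d)
  case (Infer r ds s)
  then show ?case
    using nmvl_rule_sound[OF _ assms(1), of r "map end_sequent ds" s] by (auto simp: list_all_iff)
qed

section \<open>Cut-free derivability and weakening by finite sets\<close>

definition cutfree_derivable ::
    "nat \<Rightarrow> (nat \<Rightarrow> 'v) \<Rightarrow> ('c \<Rightarrow> nat) \<Rightarrow> ('c \<Rightarrow> 'v list \<Rightarrow> 'v set) \<Rightarrow> ('p, 'c) sequent \<Rightarrow> bool" where
  "cutfree_derivable n v ar tab s \<longleftrightarrow>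
     (\<exists>d. nmvl_derivation n v ar tab d \<and> end_sequent d = s \<and>
          Cut \<notin> rules_used d \<and> Resolution \<notin> rules_used d)"

text \<open>Choosing one cut-free derivation per premise and joining them below by \<open>r\<close>
  gives the tree. Later arguments can then apply rules to sequents without handling trees.\<close>

lemma cutfree_derivableI:
  assumes rule: "nmvl_rule n v ar tab r ss s" and "r \<noteq> Cut" "r \<noteq> Resolution"
    and prems: "\<forall>t \<in> set ss. cutfree_derivable n v ar tab t"
  shows "cutfree_derivable n v ar tab s"
proof -
  obtain f where f: "\<forall>t \<in> set ss. nmvl_derivation n v ar tab (f t) \<and> end_sequent (f t) = t \<and>
      Cut \<notin> rules_used (f t) \<and> Resolution \<notin> rules_used (f t)"
    using bchoice[OF prems[unfolded cutfree_derivable_def]] by blast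
  then have "map end_sequent (map f ss) = ss"
    by (simp add: map_idI)
  then have "nmvl_derivation n v ar tab (Infer r (map f ss) s)"
    using rule f by (simp add: list_all_iff)
  moreover have "Cut \<notin> rules_used (Infer r (map f ss) s)"
    "Resolution \<notin> rules_used (Infer r (map f ss) s)"
    using f assms(2,3) by auto
  ultimately show ?thesis
    unfolding cutfree_derivable_def by (metis deriv.sel(3))
qed

lemma cutfree_derivable_wf:
  assumes "cutfree_derivable n v ar tab s"
  shows "wf_sequent n ar s"
proof -
  obtain d where "nmvl_derivation n v ar tab d" "end_sequent d = s"
    using assms by (auto simp: cutfree_derivable_def)
  then show ?thesis
    by (cases d) (auto intro: nmvl_rule_wf_sequent)
qed

lemma cutfree_weaken_left:
  assumes "cutfree_derivable n v ar tab (\<Gamma> \<turnstile> \<Delta>)" and "\<Gamma>' \<in> fin_lfms n ar"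
  shows "cutfree_derivable n v ar tab (\<Gamma> \<union> \<Gamma>' \<turnstile> \<Delta>)"
proof -
  have "finite \<Gamma>'" using assms(2) by (simp add: fin_lfms_def)
  then show ?thesis using assms(2)
  proof induction
    case (insert x \<Gamma>')
    then have IH: "cutfree_derivable n v ar tab (\<Gamma> \<union> \<Gamma>' \<turnstile> \<Delta>)"
      by (simp add: fin_lfms_def)
    obtain \<phi> k where x: "x = (\<phi>, k)" by fastforce
    have "cutfree_derivable n v ar tab (\<Gamma> \<union> \<Gamma>' \<union> {(\<phi>, k)} \<turnstile> \<Delta>)"
      using cutfree_derivable_wf[OF IH] insert.prems IH x
      by (intro cutfree_derivableI[OF nmvl_rule.LWeakening]) (auto simp: fin_lfms_def)
    then show ?case by (simp add: x)
  qed (use assms(1) in simp)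
qed

lemma cutfree_weaken_right:
  assumes "cutfree_derivable n v ar tab (\<Gamma> \<turnstile> \<Delta>)" and "\<Delta>' \<in> fin_lfms n ar"
  shows "cutfree_derivable n v ar tab (\<Gamma> \<turnstile> \<Delta> \<union> \<Delta>')"
proof -
  have "finite \<Delta>'" using assms(2) by (simp add: fin_lfms_def)
  then show ?thesis using assms(2)
  proof induction
    case (insert x \<Delta>')
    then have IH: "cutfree_derivable n v ar tab (\<Gamma> \<turnstile> \<Delta> \<union> \<Delta>')"
      by (simp add: fin_lfms_def)
    obtain \<phi> k where x: "x = (\<phi>, k)" by fastforce
    have "cutfree_derivable n v ar tab (\<Gamma> \<turnstile> \<Delta> \<union> \<Delta>' \<union> {(\<phi>, k)})"
      using cutfree_derivable_wf[OF IH] insert.prems IH x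
      by (intro cutfree_derivableI[OF nmvl_rule.RWeakening]) (auto simp: fin_lfms_def)
    then show ?case by (simp add: x)
  qed (use assms(1) in simp)
qed

text \<open>Shifting the left side of the axiom for \<open>(\<phi>, 1)\<close> to the right adds all
  the other labels; weakening then supplies \<open>\<Gamma>\<close>.\<close>

lemma cutfree_all_labels:
  assumes "\<phi> \<in> formulas ar" and "1 \<le> n" and "\<Gamma> \<in> fin_lfms n ar"
  shows "cutfree_derivable n v ar tab (\<Gamma> \<turnstile> {\<phi>} \<times> {1..n})"
proof -
  have lfm: "(\<phi>, 1) \<in> lfms n ar"
    using assms by (auto simp: lfms_def)
  then have "cutfree_derivable n v ar tab ({(\<phi>, 1)} \<turnstile> {(\<phi>, 1)})"
    by (intro cutfree_derivableI[OF nmvl_rule.Axiom]) auto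
  then have "cutfree_derivable n v ar tab ({} \<turnstile> {(\<phi>, 1)} \<union> {\<phi>} \<times> ({1..n} - {1}))"
    using lfm by (intro cutfree_derivableI[OF nmvl_rule.LShift]) (auto simp: fin_lfms_def)
  moreover have "{(\<phi>, 1)} \<union> {\<phi>} \<times> ({1..n} - {1}) = {\<phi>} \<times> {1..n}"
    using assms(2) by auto
  ultimately show ?thesis
    using cutfree_weaken_left[of n v ar tab "{}" _ \<Gamma>] assms(3) by simp
qed

section \<open>Maximal unprovable right-hand sides\<close>

text \<open>\<open>X\<close> may be infinite, whereas sequents are finite. Quantifying over finite
  \<open>D\<close> gives the property finite character, as Zorn's lemma requires here.\<close>

definition unprovable_on_right ::
    "nat \<Rightarrow> (nat \<Rightarrow> 'v) \<Rightarrow> ('c \<Rightarrow> nat) \<Rightarrow> ('c \<Rightarrow> 'v list \<Rightarrow> 'v set) \<Rightarrow>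
     ('p, 'c) lfm set \<Rightarrow> ('p, 'c) lfm set \<Rightarrow> bool" where
  "unprovable_on_right n v ar tab \<Gamma> X \<longleftrightarrow>
     X \<subseteq> lfms n ar \<and> (\<forall>D. finite D \<longrightarrow> D \<subseteq> X \<longrightarrow> \<not> cutfree_derivable n v ar tab (\<Gamma> \<turnstile> D))"

lemma ex_maximal_unprovable:
  assumes "unprovable_on_right n v ar tab \<Gamma> \<Delta>"
  shows "\<exists>M. \<Delta> \<subseteq> M \<and> unprovable_on_right n v ar tab \<Gamma> M \<and>
    (\<forall>X. unprovable_on_right n v ar tab \<Gamma> X \<longrightarrow> M \<subseteq> X \<longrightarrow> X = M)"
proof -
  let ?A = "{X. \<Delta> \<subseteq> X \<and> unprovable_on_right n v ar tab \<Gamma> X}"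
  have "\<exists>M\<in>?A. \<forall>X\<in>?A. M \<subseteq> X \<longrightarrow> X = M"
  proof (rule subset_Zorn_nonempty)
    show "?A \<noteq> {}" using assms by auto
  next
    fix C assume C: "C \<noteq> {}" "subset.chain ?A C"
    then have CA: "C \<subseteq> ?A" by (simp add: subset_chain_def)
    have "\<not> cutfree_derivable n v ar tab (\<Gamma> \<turnstile> D)" if D: "finite D" "D \<subseteq> \<Union> C" for D
    proof -
      \<comment> \<open>A finite subset of the union of a nonempty chain lies in a single
        member.\<close>
      obtain X where "X \<in> C" "D \<subseteq> X"
        by (rule finite_subset_Union_chain[OF D C])
      then show ?thesis
        using CA D(1) unfolding unprovable_on_right_def by blast
    qed
    moreover have "\<Union> C \<subseteq> lfms n ar"
      using CA by (auto simp: unprovable_on_right_def)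
    moreover have "\<Delta> \<subseteq> \<Union> C"
      using C(1) CA by fast
    ultimately show "\<Union> C \<in> ?A"
      by (simp add: unprovable_on_right_def)
  qed
  then show ?thesis by (metis (mono_tags, lifting) mem_Collect_eq order_trans)
qed

lemma maximal_unprovableD:
  assumes "unprovable_on_right n v ar tab \<Gamma> M"
    and "\<And>X. unprovable_on_right n v ar tab \<Gamma> X \<Longrightarrow> M \<subseteq> X \<Longrightarrow> X = M"
    and "(\<phi>, k) \<in> lfms n ar" "(\<phi>, k) \<notin> M"
  obtains D where "D \<in> fin_lfms n ar" "D \<subseteq> M"
    "cutfree_derivable n v ar tab (\<Gamma> \<turnstile> D \<union> {(\<phi>, k)})"
proof -
  have "\<not> unprovable_on_right n v ar tab \<Gamma> (insert (\<phi>, k) M)"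
    using assms(2)[of "insert (\<phi>, k) M"] assms(4) by auto
  then obtain D where D: "finite D" "D \<subseteq> insert (\<phi>, k) M" "cutfree_derivable n v ar tab (\<Gamma> \<turnstile> D)"
    using assms(1,3) by (auto simp: unprovable_on_right_def)
  \<comment> \<open>Weakening displays \<open>(\<phi>, k)\<close> without a case distinction on
    whether it is in \<open>D\<close>.\<close>
  have "cutfree_derivable n v ar tab (\<Gamma> \<turnstile> D \<union> {(\<phi>, k)})"
    using D(3) assms(3) by (intro cutfree_weaken_right) (auto simp: fin_lfms_def)
  then have "cutfree_derivable n v ar tab (\<Gamma> \<turnstile> (D - {(\<phi>, k)}) \<union> {(\<phi>, k)})"
    by simp
  moreover have "D - {(\<phi>, k)} \<subseteq> M" using D(2) by auto
  moreover have "D - {(\<phi>, k)} \<in> fin_lfms n ar"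
    using D(1) calculation(2) assms(1) by (auto simp: fin_lfms_def unprovable_on_right_def)
  ultimately show ?thesis using that by blast
qed

lemma maximal_unprovable_table:
  assumes M: "unprovable_on_right n v ar tab \<Gamma> M"
    and max: "\<And>X. unprovable_on_right n v ar tab \<Gamma> X \<Longrightarrow> M \<subseteq> X \<Longrightarrow> X = M"
    and \<Gamma>: "\<Gamma> \<in> fin_lfms n ar"
    and Con: "length \<phi>s = ar c" "set \<phi>s \<subseteq> formulas ar"
    and ks: "length ks = ar c" "set ks \<subseteq> {1..n}"
    and avoid: "\<And>j. j < ar c \<Longrightarrow> (\<phi>s ! j, ks ! j) \<notin> M"
  shows "\<exists>k \<in> {1..n}. v k \<in> tab c (map v ks) \<and> (Con c \<phi>s, k) \<notin> M"
proof (rule ccontr)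
  let ?E = "{(Con c \<phi>s, k) |k. k \<in> {1..n} \<and> v k \<in> tab c (map v ks)}"
  assume "\<not> ?thesis"
  then have E: "?E \<subseteq> M" by auto
  have lfm: "(\<phi>s ! j, ks ! j) \<in> lfms n ar" if "j < ar c" for j
    using that Con ks unfolding lfms_def by (metis SigmaI nth_mem subsetD)
  have "\<forall>j \<in> {..<ar c}. \<exists>D. D \<in> fin_lfms n ar \<and> D \<subseteq> M \<and>
      cutfree_derivable n v ar tab (\<Gamma> \<turnstile> D \<union> {(\<phi>s ! j, ks ! j)})"
    using maximal_unprovableD[OF M max lfm avoid] by (metis lessThan_iff)
  then obtain D where D: "\<And>j. j < ar c \<Longrightarrow> D j \<in> fin_lfms n ar" "\<And>j. j < ar c \<Longrightarrow> D j \<subseteq> M"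
      "\<And>j. j < ar c \<Longrightarrow> cutfree_derivable n v ar tab (\<Gamma> \<turnstile> D j \<union> {(\<phi>s ! j, ks ! j)})"
    by (metis lessThan_iff)
  \<comment> \<open>The table rule requires the same context in all premises, so the sets
    \<open>D j\<close> are merged and each premise is weakened to \<open>U\<close>.\<close>
  define U where "U = (\<Union>j<ar c. D j)"
  have U: "U \<in> fin_lfms n ar" "U \<subseteq> M"
    using D(1,2) unfolding U_def fin_lfms_def by blast+
  have "cutfree_derivable n v ar tab (\<Gamma> \<turnstile> U \<union> {(\<phi>s ! j, ks ! j)})" if "j < ar c" for j
  proof -
    have "D j \<union> {(\<phi>s ! j, ks ! j)} \<union> U = U \<union> {(\<phi>s ! j, ks ! j)}"
      using that by (auto simp: U_def)
    then show ?thesis using cutfree_weaken_right[OF D(3)[OF that] U(1)] by simp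
  qed
  then have "cutfree_derivable n v ar tab (\<Gamma> \<turnstile> U \<union> ?E)"
    using \<Gamma> U Con ks by (intro cutfree_derivableI[OF nmvl_rule.Table]) auto
  moreover have "finite (U \<union> ?E)"
    using U by (simp add: fin_lfms_def)
  ultimately show False
    using M U E by (metis (no_types, lifting) Un_least unprovable_on_right_def)
qed

section \<open>The countermodel valuation and completeness without cut\<close>

primrec choose_value ::
    "nat \<Rightarrow> (nat \<Rightarrow> 'v) \<Rightarrow> ('c \<Rightarrow> 'v list \<Rightarrow> 'v set) \<Rightarrow> ('p, 'c) lfm set \<Rightarrow> ('p, 'c) fm \<Rightarrow> nat" where
  "choose_value n v tab M (Var p) = (SOME k. k \<in> {1..n} \<and> (Var p, k) \<notin> M)"
| "choose_value n v tab M (Con c \<phi>s) =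
     (SOME k. k \<in> {1..n} \<and> (Con c \<phi>s, k) \<notin> M \<and>
        v k \<in> tab c (map v (map (choose_value n v tab M) \<phi>s)))"

text \<open>Each \<open>SOME\<close> has a witness: for variables because \<open>M\<close> cannot
  contain all labels of a formula, for compounds by the table lemma applied to the labels already
  chosen for the arguments.\<close>

lemma choose_value_avoids:
  assumes M: "unprovable_on_right n v ar tab \<Gamma> M"
    and max: "\<And>X. unprovable_on_right n v ar tab \<Gamma> X \<Longrightarrow> M \<subseteq> X \<Longrightarrow> X = M"
    and \<Gamma>: "\<Gamma> \<in> fin_lfms n ar" and n: "1 \<le> n"
  defines "w \<equiv> choose_value n v tab M"
  assumes "\<phi> \<in> formulas ar"
  shows "w \<phi> \<in> {1..n} \<and> (\<phi>, w \<phi>) \<notin> M \<and>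
    (\<forall>c \<phi>s. \<phi> = Con c \<phi>s \<longrightarrow> v (w \<phi>) \<in> tab c (map v (map w \<phi>s)))"
  using assms(6)
proof induction
  case (Var p)
  have "\<not> {Var p} \<times> {1..n} \<subseteq> M"
    using M cutfree_all_labels[OF formulas.Var n \<Gamma>] unfolding unprovable_on_right_def
    by (metis finite.emptyI finite.insertI finite_SigmaI finite_atLeastAtMost)
  then have "\<exists>k. k \<in> {1..n} \<and> (Var p, k) \<notin> M" by auto
  from someI_ex[OF this] show ?case by (simp add: w_def)
next
  case (Con \<phi>s c)
  have "\<exists>k \<in> {1..n}. v k \<in> tab c (map v (map w \<phi>s)) \<and> (Con c \<phi>s, k) \<notin> M"
    using Con by (intro maximal_unprovable_table[OF M max \<Gamma>]) auto
  then have "\<exists>k. k \<in> {1..n} \<and> (Con c \<phi>s, k) \<notin> M \<and> v k \<in> tab c (map v (map w \<phi>s))"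
    by blast
  from someI_ex[OF this] show ?case by (simp add: w_def)
qed

lemma cutfree_complete:
  assumes n: "1 \<le> n" and wf: "\<Gamma> \<in> fin_lfms n ar" "\<Delta> \<in> fin_lfms n ar"
    and valid: "\<And>w. legal n v ar tab w \<Longrightarrow> satisfies w (\<Gamma> \<turnstile> \<Delta>)"
  shows "cutfree_derivable n v ar tab (\<Gamma> \<turnstile> \<Delta>)"
proof (rule ccontr)
  assume underivable: "\<not> ?thesis"
  have "\<not> cutfree_derivable n v ar tab (\<Gamma> \<turnstile> D)" if "D \<subseteq> \<Delta>" for D
    using cutfree_weaken_right[of n v ar tab \<Gamma> D \<Delta>] wf(2) underivable that by (auto simp: Un_absorb1)
  then have "unprovable_on_right n v ar tab \<Gamma> \<Delta>"
    using wf(2) by (simp add: unprovable_on_right_def fin_lfms_def)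
  from ex_maximal_unprovable[OF this] obtain M
    where M: "\<Delta> \<subseteq> M" "unprovable_on_right n v ar tab \<Gamma> M"
    and "\<forall>X. unprovable_on_right n v ar tab \<Gamma> X \<longrightarrow> M \<subseteq> X \<longrightarrow> X = M"
    by (elim exE conjE)
  then have max: "\<And>X. unprovable_on_right n v ar tab \<Gamma> X \<Longrightarrow> M \<subseteq> X \<Longrightarrow> X = M"
    by simp
  define w where "w = choose_value n v tab M"
  have w: "w \<phi> \<in> {1..n} \<and> (\<phi>, w \<phi>) \<notin> M \<and>
      (\<forall>c \<phi>s. \<phi> = Con c \<phi>s \<longrightarrow> v (w \<phi>) \<in> tab c (map v (map w \<phi>s)))"
    if "\<phi> \<in> formulas ar" for \<phi>
    using choose_value_avoids[OF M(2) max wf(1) n that] by (simp add: w_def)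
  have "legal n v ar tab w"
    using w by (auto simp: legal_def)
  then have "satisfies w (\<Gamma> \<turnstile> \<Delta>)" by (rule valid)
  moreover have "w \<phi> = k" if "(\<phi>, k) \<in> \<Gamma>" for \<phi> k
  proof (rule ccontr)
    assume ne: "w \<phi> \<noteq> k"
    have lfm: "(\<phi>, k) \<in> lfms n ar" using that wf(1) by (auto simp: fin_lfms_def)
    then have \<phi>: "\<phi> \<in> formulas ar" by (simp add: lfms_def)
    then have lfm': "(\<phi>, w \<phi>) \<in> lfms n ar" using w by (simp add: lfms_def)
    obtain D where D: "D \<in> fin_lfms n ar" "D \<subseteq> M"
      "cutfree_derivable n v ar tab (\<Gamma> \<turnstile> D \<union> {(\<phi>, w \<phi>)})"
      using maximal_unprovableD[OF M(2) max lfm'] w[OF \<phi>] by blast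
    \<comment> \<open>The right shift trades the label \<open>w \<phi>\<close> on the right for
      \<open>k\<close> on the left, where \<open>\<Gamma>\<close> absorbs it. This derives the
      finite subset \<open>D\<close> of \<open>M\<close>.\<close>
    then have "cutfree_derivable n v ar tab (\<Gamma> \<union> {(\<phi>, k)} \<turnstile> D)"
      using wf(1) lfm lfm' ne by (intro cutfree_derivableI[OF nmvl_rule.RShift[where k' = "w \<phi>"]]) auto
    then have "cutfree_derivable n v ar tab (\<Gamma> \<turnstile> D)"
      using that by (simp add: insert_absorb)
    then show False using M(2) D by (simp add: unprovable_on_right_def fin_lfms_def)
  qed
  \<comment> \<open>The left side holds under \<open>w\<close>, so some member of
    \<open>\<Delta>\<close> must hold too; but \<open>\<Delta>\<close> lies in \<open>M\<close>,
    which \<open>w\<close> avoids.\<close>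
  ultimately obtain \<phi> where "(\<phi>, w \<phi>) \<in> \<Delta>" by auto
  moreover from this have "\<phi> \<in> formulas ar" using wf(2) by (auto simp: fin_lfms_def lfms_def)
  ultimately show False using w M(1) by blast
qed

theorem theorem2:
  fixes n :: nat
    and v :: "nat \<Rightarrow> 'v"
    and ar :: "'c \<Rightarrow> nat"
    and tab :: "'c \<Rightarrow> 'v list \<Rightarrow> 'v set"
    and s :: "('p, 'c) sequent"
  assumes "nmatrix n v ar tab"
    and "nmvl_derivable n v ar tab s"
  shows "\<exists>d. nmvl_derivation n v ar tab d \<and> end_sequent d = s \<and>
             Cut \<notin> rules_used d \<and> Resolution \<notin> rules_used d"
proof -
  obtain d where d: "nmvl_derivation n v ar tab d" "end_sequent d = s"
    using assms(2) by (auto simp: nmvl_derivable_def)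
  obtain \<Gamma> \<Delta> where s: "s = (\<Gamma> \<turnstile> \<Delta>)" by (cases s)
  have "wf_sequent n ar s"
    using d by (cases d) (auto intro: nmvl_rule_wf_sequent)
  moreover have "1 \<le> n" using assms(1) by (simp add: nmatrix_def)
  \<comment> \<open>Soundness covers cut and resolution as well, so validity is all that is kept of
    the given derivation.\<close>
  moreover have "satisfies w s" if "legal n v ar tab w" for w
    using nmvl_derivation_sound[OF that d(1)] d(2) by simp
  ultimately have "cutfree_derivable n v ar tab s"
    unfolding s by (intro cutfree_complete) auto
  then show ?thesis by (simp add: cutfree_derivable_def)
qed

end
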